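(* Let $X$ be a complex Banach space, let $P$ be a bounded linear projection on $X$, and let $R=2P-I$. Then there is a norm on $X$, equivalent to the original norm, with respect to which $R$ is an isometric reflection, and consequently $P$ is a generalized bi-circular projection on $X$ with respect to this norm.
   Context: $I$ is the identity operator on $X$ and $\mathbb{T}$ is the set of complex numbers of modulus $1$. A projection is a bounded linear operator $P$ with $P^2=P$. A reflection is a bounded linear operator $R$ with $R^2=I$; an isometric reflection is a reflection that is also an isometry. A projection $P$ on a complex Banach space is a generalized bi-circular projection if there exists $\lambda\in\mathbb{T}\setminus\{1\}$ such that $P+\lambda(I-P)$ is an isometry. *)

theory Defs
  imports "HOL-Analysis.Analysis"
begin

text \<open>
  HOL-Analysis only has real Banach spaces. A complex Banach space is a real one (class
  \<^class>\<open>banach\<close>) with a complex scalar multiplication that extends the real one and for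
  which the norm is absolutely homogeneous.
\<close>

class complex_banach = banach +
  fixes scaleC :: "complex \<Rightarrow> 'a \<Rightarrow> 'a" (infixr "*\<^sub>C" 75)
  assumes scaleC_add_right: "a *\<^sub>C (x + y) = a *\<^sub>C x + a *\<^sub>C y"
    and scaleC_add_left: "(a + b) *\<^sub>C x = a *\<^sub>C x + b *\<^sub>C x"
    and scaleC_scaleC: "a *\<^sub>C b *\<^sub>C x = (a * b) *\<^sub>C x"
    and scaleC_one: "1 *\<^sub>C x = x"
    and scaleR_scaleC: "r *\<^sub>R x = complex_of_real r *\<^sub>C x"
    and norm_scaleC: "norm (a *\<^sub>C x) = cmod a * norm x"

instantiation complex :: complex_banach
begin

definition scaleC_complex :: "complex \<Rightarrow> complex \<Rightarrow> complex"
  where "scaleC_complex a x = a * x"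

instance
  by standard (simp_all add: scaleC_complex_def algebra_simps norm_mult scaleR_conv_of_real)

end

text \<open>
  Since the space is to be renormed, the norm \<open>N\<close> is an explicit argument of the notions
  below; the original norm is the instance \<open>N = norm\<close>.
\<close>

definition complex_norm :: "('a::complex_banach \<Rightarrow> real) \<Rightarrow> bool"
  where "complex_norm N \<longleftrightarrow>
    (\<forall>x. N x \<ge> 0) \<and>
    (\<forall>x. N x = 0 \<longleftrightarrow> x = 0) \<and>
    (\<forall>a x. N (a *\<^sub>C x) = cmod a * N x) \<and>
    (\<forall>x y. N (x + y) \<le> N x + N y)"

definition complete_norm :: "('a::complex_banach \<Rightarrow> real) \<Rightarrow> bool"
  where "complete_norm N \<longleftrightarrow>
    (\<forall>X :: nat \<Rightarrow> 'a.
      (\<forall>e>0. \<exists>M. \<forall>m\<ge>M. \<forall>n\<ge>M. N (X m - X n) < e) \<longrightarrow>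
      (\<exists>l. (\<lambda>n. N (X n - l)) \<longlonglongrightarrow> 0))"

definition equivalent_norms ::
  "('a::complex_banach \<Rightarrow> real) \<Rightarrow> ('a \<Rightarrow> real) \<Rightarrow> bool"
  where "equivalent_norms N N' \<longleftrightarrow>
    (\<exists>c>0. \<exists>C>0. \<forall>x. c * N x \<le> N' x \<and> N' x \<le> C * N x)"

definition bounded_clinear_wrt ::
  "('a::complex_banach \<Rightarrow> real) \<Rightarrow> ('a \<Rightarrow> 'a) \<Rightarrow> bool"
  where "bounded_clinear_wrt N T \<longleftrightarrow>
    (\<forall>x y. T (x + y) = T x + T y) \<and>
    (\<forall>a x. T (a *\<^sub>C x) = a *\<^sub>C T x) \<and>
    (\<exists>K. \<forall>x. N (T x) \<le> K * N x)"

lemma bounded_clinear_wrt_norm_iff: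
  "bounded_clinear_wrt norm T \<longleftrightarrow>
    bounded_linear T \<and> (\<forall>a x. T (a *\<^sub>C x) = a *\<^sub>C T x)"
  by (auto simp: bounded_clinear_wrt_def bounded_linear_def bounded_linear_axioms_def
      linear_iff scaleR_scaleC mult.commute)

lemma complex_norm_norm: "complex_norm norm"
  by (simp add: complex_norm_def norm_scaleC norm_triangle_ineq)

lemma complete_norm_norm: "complete_norm norm"
  unfolding complete_norm_def
proof (intro allI impI)
  fix X :: "nat \<Rightarrow> 'a"
  assume "\<forall>e>0. \<exists>M. \<forall>m\<ge>M. \<forall>n\<ge>M. norm (X m - X n) < e"
  then have "Cauchy X"
    by (simp add: Cauchy_def dist_norm)
  then show "\<exists>l. (\<lambda>n. norm (X n - l)) \<longlonglongrightarrow> 0"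
    by (metis Cauchy_convergent_iff LIM_zero convergent_def tendsto_norm_zero)
qed

definition isometry_wrt ::
  "('a::complex_banach \<Rightarrow> real) \<Rightarrow> ('a \<Rightarrow> 'a) \<Rightarrow> bool"
  where "isometry_wrt N T \<longleftrightarrow> (\<forall>x y. N (T x - T y) = N (x - y))"

definition projection_wrt ::
  "('a::complex_banach \<Rightarrow> real) \<Rightarrow> ('a \<Rightarrow> 'a) \<Rightarrow> bool"
  where "projection_wrt N P \<longleftrightarrow> bounded_clinear_wrt N P \<and> P \<circ> P = P"

definition reflection_wrt ::
  "('a::complex_banach \<Rightarrow> real) \<Rightarrow> ('a \<Rightarrow> 'a) \<Rightarrow> bool"
  where "reflection_wrt N R \<longleftrightarrow> bounded_clinear_wrt N R \<and> R \<circ> R = id"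

definition isometric_reflection_wrt ::
  "('a::complex_banach \<Rightarrow> real) \<Rightarrow> ('a \<Rightarrow> 'a) \<Rightarrow> bool"
  where "isometric_reflection_wrt N R \<longleftrightarrow> reflection_wrt N R \<and> isometry_wrt N R"

definition generalized_bicircular_projection_wrt ::
  "('a::complex_banach \<Rightarrow> real) \<Rightarrow> ('a \<Rightarrow> 'a) \<Rightarrow> bool"
  where "generalized_bicircular_projection_wrt N P \<longleftrightarrow>
    complex_norm N \<and> complete_norm N \<and> projection_wrt N P \<and>
    (\<exists>\<mu>. cmod \<mu> = 1 \<and> \<mu> \<noteq> 1 \<and> isometry_wrt N (\<lambda>x. P x + \<mu> *\<^sub>C (x - P x)))"

end

theory Submission imports Defs begin

text \<open>
  Summing the norm over the orbits of the group \<open>{I, R}\<close> makes \<open>R\<close> an isometry: with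
  \<open>N x = \<parallel>x\<parallel> + \<parallel>R x\<parallel>\<close>, applying \<open>R\<close> merely swaps the two summands, because \<open>R\<^sup>2 = I\<close>
  (which is \<open>P\<^sup>2 = P\<close> in terms of \<open>R = 2P - I\<close>). Boundedness of \<open>R\<close> gives
  \<open>\<parallel>x\<parallel> \<le> N x \<le> (1 + \<parallel>R\<parallel>) \<parallel>x\<parallel>\<close>, so \<open>N\<close> is equivalent to the original norm, and completeness
  and boundedness of operators carry over to \<open>N\<close>.
  Finally \<open>P + (-1)(I - P) = R\<close>, so \<open>\<lambda> = -1\<close> is a witness for \<open>P\<close> being a generalized
  bi-circular projection.
\<close>

lemma scaleC_minus_one: "(-1) *\<^sub>C x = - (x::'a::complex_banach)"
  using scaleR_scaleC[of "-1" x] by simp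

lemma scaleC_two: "2 *\<^sub>C x = x + (x::'a::complex_banach)"
  using scaleR_scaleC[of 2 x] by (simp add: scaleR_2)

lemma scaleC_diff_right: "a *\<^sub>C (x - y) = a *\<^sub>C x - a *\<^sub>C (y::'a::complex_banach)"
  using scaleC_add_right[of a "x - y" y] by (simp add: algebra_simps)

text \<open>
  Equivalent norms have the same Cauchy sequences and the same null sequences.
\<close>

lemma complete_norm_equivalent:
  assumes compl: "complete_norm N" and N: "complex_norm N" and eq: "equivalent_norms N N'"
  shows "complete_norm N'"
  unfolding complete_norm_def
proof (intro allI impI)
  obtain c C where c: "c > 0" "C > 0" and low: "\<And>x. c * N x \<le> N' x"
    and up: "\<And>x. N' x \<le> C * N x"
    using eq unfolding equivalent_norms_def by blast
  have "0 \<le> c * N x" for x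
    using N c by (simp add: complex_norm_def)
  then have pos: "0 \<le> N' x" for x
    using low order_trans by blast
  fix X :: "nat \<Rightarrow> 'a"
  assume cauchy: "\<forall>e>0. \<exists>M. \<forall>m\<ge>M. \<forall>n\<ge>M. N' (X m - X n) < e"
  have "\<exists>M. \<forall>m\<ge>M. \<forall>n\<ge>M. N (X m - X n) < e" if "e > 0" for e
  proof -
    obtain M where M: "\<And>m n. m \<ge> M \<Longrightarrow> n \<ge> M \<Longrightarrow> N' (X m - X n) < c * e"
      using cauchy \<open>e > 0\<close> c(1) by (meson mult_pos_pos)
    have "N (X m - X n) < e" if "m \<ge> M" "n \<ge> M" for m n
      using le_less_trans[OF low M[OF that]] c(1) by simp
    then show ?thesis by blast
  qed
  then obtain l where "(\<lambda>n. N (X n - l)) \<longlonglongrightarrow> 0"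
    using compl unfolding complete_norm_def by blast
  then have lim: "(\<lambda>n. C * N (X n - l)) \<longlonglongrightarrow> 0"
    by (rule tendsto_mult_right_zero)
  have "(\<lambda>n. N' (X n - l)) \<longlonglongrightarrow> 0"
    by (rule tendsto_sandwich[OF _ _ tendsto_const lim]) (simp_all add: pos up)
  then show "\<exists>l. (\<lambda>n. N' (X n - l)) \<longlonglongrightarrow> 0" by blast
qed

text \<open>
  If \<open>K\<close> bounds \<open>T\<close> for \<open>N\<close> and \<open>c N \<le> N' \<le> C N\<close>, then \<open>C \<bar>K\<bar> / c\<close> bounds it for \<open>N'\<close>;
  the absolute value keeps the estimate monotone, as \<open>K\<close> may be negative on the zero space.
\<close>

lemma bounded_clinear_wrt_equivalent:
  assumes T: "bounded_clinear_wrt N T" and N: "complex_norm N" and eq: "equivalent_norms N N'"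
  shows "bounded_clinear_wrt N' T"
proof -
  obtain c C where c: "c > 0" "C > 0" and low: "\<And>x. c * N x \<le> N' x"
    and up: "\<And>x. N' x \<le> C * N x"
    using eq unfolding equivalent_norms_def by blast
  obtain K where K: "\<And>x. N (T x) \<le> K * N x"
    using T unfolding bounded_clinear_wrt_def by blast
  have "N' (T x) \<le> (C * \<bar>K\<bar> / c) * N' x" for x
  proof -
    have "N (T x) \<le> \<bar>K\<bar> * N x"
      using K[of x] N by (meson abs_ge_self complex_norm_def mult_right_mono order_trans)
    also have "\<dots> \<le> \<bar>K\<bar> * (N' x / c)"
      using low[of x] c(1) by (intro mult_left_mono) (simp_all add: field_simps)
    finally have "C * N (T x) \<le> C * (\<bar>K\<bar> * (N' x / c))"
      using c(2) by (intro mult_left_mono) simp_all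
    then show ?thesis
      using up[of "T x"] by simp
  qed
  then show ?thesis
    using T unfolding bounded_clinear_wrt_def by blast
qed

lemma complex_norm_add_norm_image:
  assumes "bounded_clinear_wrt norm T"
  shows "complex_norm (\<lambda>x. norm x + norm (T x))"
proof -
  have lin: "T (x + y) = T x + T y" "T (a *\<^sub>C x) = a *\<^sub>C T x" for a x y
    using assms by (simp_all add: bounded_clinear_wrt_def)
  have "T 0 = 0"
    using lin(1)[of 0 0] by simp
  moreover have "norm (x + y) + norm (T x + T y) \<le> norm x + norm (T x) + (norm y + norm (T y))"
    for x y
    using norm_triangle_ineq[of x y] norm_triangle_ineq[of "T x" "T y"] by linarith
  ultimately show ?thesis
    by (auto simp: complex_norm_def lin norm_scaleC algebra_simps add_nonneg_eq_0_iff)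
qed

lemma equivalent_norms_add_norm_image:
  assumes "bounded_clinear_wrt norm T"
  shows "equivalent_norms norm (\<lambda>x. norm x + norm (T x))"
proof -
  have "bounded_linear T"
    using assms by (simp add: bounded_clinear_wrt_norm_iff)
  then obtain K where "K > 0" and "\<And>x. norm (T x) \<le> norm x * K"
    using bounded_linear.pos_bounded by blast
  then have "1 * norm x \<le> norm x + norm (T x) \<and> norm x + norm (T x) \<le> (1 + K) * norm x" for x
    by (simp add: algebra_simps)
  then show ?thesis
    using \<open>K > 0\<close> unfolding equivalent_norms_def by (meson add_pos_pos zero_less_one)
qed

text \<open>
  \<open>T\<close> swaps the summands \<open>\<parallel>x\<parallel>\<close> and \<open>\<parallel>T x\<parallel>\<close>, since \<open>T (T x) = x\<close>.
\<close>

lemma isometric_reflection_add_norm_image: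
  assumes "reflection_wrt norm T"
  shows "isometric_reflection_wrt (\<lambda>x. norm x + norm (T x)) T"
proof -
  have T: "bounded_clinear_wrt norm T" and inv: "T (T x) = x" for x
    using assms by (auto simp: reflection_wrt_def fun_eq_iff)
  have "T (x - y) = T x - T y" for x y
    using T by (simp add: bounded_clinear_wrt_norm_iff bounded_linear.linear linear_diff)
  then have "isometry_wrt (\<lambda>x. norm x + norm (T x)) T"
    by (simp add: isometry_wrt_def inv)
  moreover have "bounded_clinear_wrt (\<lambda>x. norm x + norm (T x)) T"
    using T complex_norm_norm equivalent_norms_add_norm_image[OF T]
    by (rule bounded_clinear_wrt_equivalent)
  ultimately show ?thesis
    using assms by (simp add: isometric_reflection_wrt_def reflection_wrt_def)
qed

lemma reflection_of_projection:
  fixes P :: "'a::complex_banach \<Rightarrow> 'a"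
  assumes "projection_wrt norm P"
  shows "reflection_wrt norm (\<lambda>x. 2 *\<^sub>C P x - x)"
proof -
  have bl: "bounded_linear P" and homog: "P (a *\<^sub>C x) = a *\<^sub>C P x" and idem: "P (P x) = P x"
    for a x
    using assms by (auto simp: projection_wrt_def bounded_clinear_wrt_norm_iff fun_eq_iff)
  have "bounded_linear (\<lambda>x. P x + P x - x)"
    by (intro bounded_linear_sub bounded_linear_add bl bounded_linear_ident)
  then have "bounded_clinear_wrt norm (\<lambda>x. 2 *\<^sub>C P x - x)"
    by (simp add: bounded_clinear_wrt_norm_iff scaleC_two scaleC_diff_right scaleC_add_right homog)
  moreover have "2 *\<^sub>C P (2 *\<^sub>C P x - x) - (2 *\<^sub>C P x - x) = x" for x
    by (simp add: scaleC_two linear_diff linear_add bounded_linear.linear bl idem)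
  ultimately show ?thesis
    by (simp add: reflection_wrt_def fun_eq_iff)
qed

text \<open>
  The choice \<open>\<lambda> = -1\<close> turns \<open>P + \<lambda>(I - P)\<close> into the reflection \<open>2P - I\<close>.
\<close>

lemma generalized_bicircular_if_reflection_isometry:
  assumes "complex_norm N" "complete_norm N" "projection_wrt N P"
    and iso: "isometry_wrt N (\<lambda>x. 2 *\<^sub>C P x - x)"
  shows "generalized_bicircular_projection_wrt N P"
proof -
  have "(\<lambda>x. P x + (-1) *\<^sub>C (x - P x)) = (\<lambda>x. 2 *\<^sub>C P x - x)"
    unfolding scaleC_minus_one scaleC_two by (simp add: algebra_simps)
  then have "isometry_wrt N (\<lambda>x. P x + (-1) *\<^sub>C (x - P x))"
    using iso by simp
  moreover have "cmod (-1) = 1" "(-1 :: complex) \<noteq> 1"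
    by simp_all
  ultimately show ?thesis
    using assms(1-3) unfolding generalized_bicircular_projection_wrt_def by blast
qed

theorem proposition2p5:
  fixes P R :: "'a::complex_banach \<Rightarrow> 'a"
  assumes "projection_wrt norm P"
    and "R = (\<lambda>x. 2 *\<^sub>C P x - x)"
  shows "\<exists>N :: 'a \<Rightarrow> real.
    complex_norm N \<and> equivalent_norms norm N \<and>
    isometric_reflection_wrt N R \<and>
    generalized_bicircular_projection_wrt N P"
proof -
  define N where "N = (\<lambda>x. norm x + norm (R x))"
  have refl: "reflection_wrt norm R"
    using reflection_of_projection[OF assms(1)] assms(2) by simp
  then have R: "bounded_clinear_wrt norm R"
    by (simp add: reflection_wrt_def)
  have N: "complex_norm N" and eq: "equivalent_norms norm N"
    using complex_norm_add_norm_image[OF R] equivalent_norms_add_norm_image[OF R]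
    by (simp_all add: N_def)
  have iso: "isometric_reflection_wrt N R"
    using isometric_reflection_add_norm_image[OF refl] by (simp add: N_def)
  have "complete_norm N"
    using complete_norm_norm complex_norm_norm eq by (rule complete_norm_equivalent)
  moreover have "projection_wrt N P"
    using assms(1) bounded_clinear_wrt_equivalent[OF _ complex_norm_norm eq]
    by (simp add: projection_wrt_def)
  ultimately have "generalized_bicircular_projection_wrt N P"
    using N iso assms(2)
    by (intro generalized_bicircular_if_reflection_isometry)
      (simp_all add: isometric_reflection_wrt_def)
  then show ?thesis
    using N eq iso by blast
qed

end
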